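(* Let $s\ge 1$ be an integer and let $G$ be a bikernel-perfect oriented graph having girth $g\ge 5$. If $\chi(G)\ge 2s^{1+\frac{4}{g-4}}$, then $G$ contains every oriented tree on $s$ vertices as an induced subgraph.
   Context: All graphs are finite. An oriented graph is an orientation of a simple graph; its girth and chromatic number are those of the underlying undirected graph. A kernel of a directed graph $D$ is an independent set $S$ such that every vertex $u\notin S$ has an out-neighbour in $S$ (i.e. some $v\in S$ with $(u,v)$ an arc). An antikernel is an independent set $S$ such that every $u\notin S$ has an in-neighbour in $S$ (some $v\in S$ with $(v,u)$ an arc). $D$ is bikernel-perfect if every induced subdigraph of $D$ has both a kernel and an antikernel. An oriented tree is an orientation of a tree; containing it as an induced subgraph means some vertex subset induces a subdigraph isomorphic to it as a directed graph. *)

theory Defs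
  imports "Graph_Theory.Digraph_Isomorphism" "HOL-Library.Extended_Real"
begin

text \<open>
  Undirected simple graphs are symmetric digraphs without loops and parallel arcs, as in the
  imported digraph library. There the closed walk a, b, a counts as a cycle, and the constants
  \<^const>\<open>forest\<close> and \<^const>\<open>tree\<close> only exclude directed cycles; hence the
  undirected versions below.
\<close>

locale oriented_graph = digraph +
  assumes no_opposite_arcs: "u \<rightarrow>\<^bsub>G\<^esub> v \<Longrightarrow> \<not> v \<rightarrow>\<^bsub>G\<^esub> u"

definition underlying_graph :: "('a, 'b) pre_digraph \<Rightarrow> ('a, 'a \<times> 'a) pre_digraph" where
  "underlying_graph D = with_proj (mk_symmetric D)"

text \<open>In a simple symmetric digraph, a closed walk of length at least 3 without repeated
  vertices is exactly a cycle of the undirected graph, traversed in some direction.\<close>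

definition undirected_cycle :: "('a, 'b) pre_digraph \<Rightarrow> 'b awalk \<Rightarrow> bool" where
  "undirected_cycle H p \<longleftrightarrow> pre_digraph.cycle H p \<and> 3 \<le> length p"

text \<open>The infimum of the empty set is \<open>\<infinity>\<close>, so acyclic graphs have infinite girth.\<close>

definition girth :: "('a, 'b) pre_digraph \<Rightarrow> enat" where
  "girth H = (INF p \<in> {p. undirected_cycle H p}. enat (length p))"

definition proper_colouring :: "('a, 'b) pre_digraph \<Rightarrow> nat \<Rightarrow> ('a \<Rightarrow> nat) \<Rightarrow> bool" where
  "proper_colouring H k c \<longleftrightarrow>
     (\<forall>v \<in> verts H. c v < k) \<and> (\<forall>u v. u \<rightarrow>\<^bsub>H\<^esub> v \<longrightarrow> c u \<noteq> c v)"

definition chromatic_number :: "('a, 'b) pre_digraph \<Rightarrow> nat" where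
  "chromatic_number H = (LEAST k. \<exists>c. proper_colouring H k c)"

definition independent_set :: "('a, 'b) pre_digraph \<Rightarrow> 'a set \<Rightarrow> bool" where
  "independent_set D S \<longleftrightarrow> S \<subseteq> verts D \<and> (\<forall>u \<in> S. \<forall>v \<in> S. \<not> u \<rightarrow>\<^bsub>D\<^esub> v)"

definition kernel :: "('a, 'b) pre_digraph \<Rightarrow> 'a set \<Rightarrow> bool" where
  "kernel D S \<longleftrightarrow> independent_set D S \<and> (\<forall>u \<in> verts D - S. \<exists>v \<in> S. u \<rightarrow>\<^bsub>D\<^esub> v)"

definition antikernel :: "('a, 'b) pre_digraph \<Rightarrow> 'a set \<Rightarrow> bool" where
  "antikernel D S \<longleftrightarrow> independent_set D S \<and> (\<forall>u \<in> verts D - S. \<exists>v \<in> S. v \<rightarrow>\<^bsub>D\<^esub> u)"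

definition bikernel_perfect :: "('a, 'b) pre_digraph \<Rightarrow> bool" where
  "bikernel_perfect D \<longleftrightarrow>
     (\<forall>X \<subseteq> verts D. (\<exists>S. kernel (D \<restriction> X) S) \<and> (\<exists>S. antikernel (D \<restriction> X) S))"

definition oriented_tree :: "('a, 'b) pre_digraph \<Rightarrow> bool" where
  "oriented_tree T \<longleftrightarrow> oriented_graph T \<and> Digraph_Component.connected T \<and>
     \<not> (\<exists>p. undirected_cycle (underlying_graph T) p)"

definition contains_induced :: "('a, 'b) pre_digraph \<Rightarrow> ('c, 'd) pre_digraph \<Rightarrow> bool" where
  "contains_induced D T \<longleftrightarrow> (\<exists>X \<subseteq> verts D. digraph_iso T (D \<restriction> X))"

end

theory Submission
  imports Defs
begin

text \<open>
  Removing kernels and antikernels one after the other from \<open>G\<close> yields disjoint layers, such that every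
  vertex of a later layer has an out-neighbour (or in-neighbour, as prescribed) in each earlier one.
  If \<open>m * (s - 1) < \<chi>(G)\<close>, reserve \<open>m\<close> layers for each non-root vertex of the tree: starting from a
  vertex left over for the root, every \<open>c :: {1..<s} \<rightarrow> {..<m}\<close> gives an embedding of the tree, the
  vertex \<open>i\<close> going to its layer number \<open>c i\<close>. Let \<open>2 * L + 2\<close> be less than the girth. If non-adjacent
  tree vertices \<open>x, y\<close> get adjacent images, their tree path has more than \<open>2 * L\<close> edges, so one of them, say
  \<open>x\<close>, lies more than \<open>L\<close> steps below their last common ancestor. Short paths in \<open>G\<close> being unique, the
  \<open>L\<close> choices just above \<open>x\<close> are then determined by all others; hence a pair is bad for at most a
  fraction \<open>m\<close> to the power \<open>- L\<close> of all \<open>c\<close>. When \<open>s ^ 2 \<le> m ^ L\<close>, some \<open>c\<close> has no bad pair. For finite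
  girth take \<open>m = \<lceil>s powr (4 / (g - 4))\<rceil>\<close> and \<open>L = (g - 3) div 2\<close>; for infinite girth, \<open>m = 2\<close> and any
  large \<open>L\<close>.
\<close>

section \<open>Unique short paths in relations without short cycles\<close>

text \<open>A cycle is the list of its vertices. Lengths below 3 are exempt because a symmetric
  relation closes up every single edge.\<close>

definition no_short_cycles :: "('a \<Rightarrow> 'a \<Rightarrow> bool) \<Rightarrow> nat \<Rightarrow> bool" where
  "no_short_cycles R n \<longleftrightarrow>
     (\<forall>xs. 3 \<le> length xs \<and> length xs \<le> n \<and> distinct xs \<and> successively R xs \<longrightarrow> \<not> R (last xs) (hd xs))"

text \<open>Two distinct paths with common ends separate and meet again, which closes a cycle no
  longer than both together. Without the start \<open>u\<close>, the lists \<open>xs\<close> and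
  \<open>ys\<close> have as many entries as the paths have edges.\<close>

lemma unique_short_path:
  assumes "symp R" and "no_short_cycles R n"
    and "successively R (u # xs)" "successively R (u # ys)"
    and "distinct (u # xs)" "distinct (u # ys)"
    and "last (u # xs) = last (u # ys)"
    and "length xs + length ys \<le> n"
  shows "xs = ys"
  using assms(3-)
proof (induction xs arbitrary: u ys)
  case Nil
  then show ?case
    by (cases ys) (auto split: if_splits)
next
  case (Cons a xs')
  then obtain b ys' where ys: "ys = b # ys'"
    by (cases ys) (auto split: if_splits)
  show ?case
  proof (cases "a = b")
    case True
    then have "xs' = ys'"
      using Cons.prems ys by (intro Cons.IH[of a]) (auto simp: successively_Cons)
    with True ys show ?thesis by simp
  next
    case False
    let ?xs = "a # xs'"
    have "last ?xs = last ys" using Cons.prems ys by simp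
    then have "\<exists>x\<in>set ?xs. x \<in> set ys"
      using ys by (metis last_in_set list.distinct(1))
    \<comment> \<open>\<open>w\<close> is the first vertex at which \<open>?xs\<close> meets
      \<open>ys\<close>. Hence \<open>p\<close> avoids \<open>ys\<close>, and the cycle
      \<open>?c\<close>, out along \<open>p\<close> to \<open>w\<close> and back along
      \<open>q\<close>, repeats no vertex.\<close>
    then obtain p w p' where p: "?xs = p @ w # p'" "w \<in> set ys" "\<forall>z\<in>set p. z \<notin> set ys"
      using split_list_first_prop[of ?xs "\<lambda>x. x \<in> set ys"] by blast
    then obtain q q' where q: "ys = q @ w # q'"
      by (meson split_list)
    let ?c = "u # p @ w # rev q"
    \<comment> \<open>If both were empty, \<open>w\<close> would be the first vertex of both lists,
      against \<open>a \<noteq> b\<close>.\<close>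
    have "p \<noteq> [] \<or> q \<noteq> []"
      using False p(1) q ys by auto
    then have 1: "3 \<le> length ?c"
      by (cases p; cases q) auto
    have "length ?xs = length p + 1 + length p'" "length ys = length q + 1 + length q'"
      using p(1) q by simp_all
    then have 2: "length ?c \<le> n"
      using Cons.prems(6) by simp
    have 3: "distinct ?c"
      using Cons.prems(3,4) p q unfolding p(1) by auto
    have "successively R (u # p @ [w])"
    proof -
      have "successively R ((u # p @ [w]) @ p')"
        using Cons.prems(1) p(1) by simp
      then show ?thesis by (simp only: successively_append_iff)
    qed
    moreover have uq: "successively R (u # q @ [w])"
    proof -
      have "successively R ((u # q @ [w]) @ q')"
        using Cons.prems(2) q by simp
      then show ?thesis by (simp only: successively_append_iff)
    qed
    then have "successively R (w # rev q)"
    proof -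
      have "successively R (q @ [w])"
        using uq by (simp add: successively_Cons)
      then have "successively (\<lambda>x y. R y x) (rev (q @ [w]))"
        by (simp only: successively_rev)
      then have "successively (\<lambda>x y. R y x) (w # rev q)" by simp
      then show ?thesis
        using assms(1) by (elim successively_mono) (auto dest: sympD)
    qed
    ultimately have 4: "successively R ?c"
      by (auto simp: successively_append_iff successively_Cons hd_append split: if_splits)
    have "last ?c = hd ys"
      using q by (cases q) auto
    moreover have "R u (hd ys)"
      using Cons.prems(2) ys by simp
    ultimately have "R (last ?c) (hd ?c)"
      using assms(1) by (metis list.sel(1) sympD)
    with 1 2 3 4 assms(2) show ?thesis
      unfolding no_short_cycles_def by blast
  qed
qed

section \<open>Rooted trees given by parent functions\<close>

text \<open>A rooted tree on an initial segment of \<open>nat\<close> is encoded by \<open>par\<close> with \<open>par i \<le> i - 1\<close>; the truncated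
  subtraction makes the root \<open>0\<close> its own parent.\<close>

definition parent_adj :: "(nat \<Rightarrow> nat) \<Rightarrow> nat \<Rightarrow> nat \<Rightarrow> bool" where
  "parent_adj par i j \<longleftrightarrow> 0 < i \<and> j = par i \<or> 0 < j \<and> i = par j"

lemma parent_adj_sym: "parent_adj par i j \<longleftrightarrow> parent_adj par j i"
  by (auto simp: parent_adj_def)

lemma funpow_parent_le:
  fixes par :: "nat \<Rightarrow> nat"
  assumes "\<And>i. par i \<le> i - 1"
  shows "(par ^^ k) x \<le> x - k"
proof (induction k)
  case (Suc k)
  have "(par ^^ Suc k) x \<le> (par ^^ k) x - 1" using assms by simp
  with Suc show ?case by linarith
qed simp

lemma funpow_parent_less:
  fixes par :: "nat \<Rightarrow> nat"
  assumes "\<And>i. par i \<le> i - 1" "i < j" "0 < (par ^^ i) x"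
  shows "(par ^^ j) x < (par ^^ i) x"
proof -
  have "(par ^^ j) x = (par ^^ (j - i)) ((par ^^ i) x)"
    using assms(2) by (metis add.commute comp_apply funpow_add le_add_diff_inverse less_imp_le)
  also have "\<dots> \<le> (par ^^ i) x - (j - i)"
    by (rule funpow_parent_le) (rule assms(1))
  finally show ?thesis using assms(2,3) by linarith
qed

text \<open>The path climbs \<open>k\<close> steps from \<open>x\<close> to the last common ancestor
  and descends \<open>l\<close> steps to \<open>y\<close>. Replacing the larger endpoint by its
  parent leaves a path among smaller numbers, so the endpoint taken away is new to it.\<close>

lemma parent_path:
  assumes par: "\<And>i. par i \<le> i - 1"
  shows "\<exists>k l xs. length xs = k + l + 1 \<and> hd xs = x \<and> last xs = y \<and> distinct xs
    \<and> successively (parent_adj par) xs \<and> set xs \<subseteq> {..max x y}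
    \<and> (\<forall>i<k. \<forall>j. (par ^^ i) x \<noteq> (par ^^ j) y) \<and> (\<forall>j<l. \<forall>i. (par ^^ j) y \<noteq> (par ^^ i) x)"
proof (induction "x + y" arbitrary: x y rule: less_induct)
  case less
  \<comment> \<open>For \<open>i = 0\<close>, the vertex \<open>a\<close> exceeds \<open>b\<close>
    and thus all ancestors of \<open>b\<close>; larger \<open>i\<close> reduce to
    \<open>par a\<close>.\<close>
  have step: "\<forall>i<Suc k. \<forall>j. (par ^^ i) a \<noteq> (par ^^ j) b"
    if "b < a" "\<forall>i<k. \<forall>j. (par ^^ i) (par a) \<noteq> (par ^^ j) b" for a b k
  proof (intro allI impI)
    fix i j assume "i < Suc k"
    have "(par ^^ j) b \<le> b" using funpow_parent_le[OF par, of j b] by simp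
    with that \<open>i < Suc k\<close> show "(par ^^ i) a \<noteq> (par ^^ j) b"
      by (cases i) (auto simp del: funpow.simps simp: funpow_Suc_right)
  qed
  have keep: "\<forall>j<l. \<forall>i. (par ^^ j) b \<noteq> (par ^^ i) a"
    if "b < a" "\<forall>j<l. \<forall>i. (par ^^ j) b \<noteq> (par ^^ i) (par a)" for a b l
  proof (intro allI impI)
    fix i j assume "j < l"
    have "(par ^^ j) b \<le> b" using funpow_parent_le[OF par, of j b] by simp
    with that \<open>j < l\<close> show "(par ^^ j) b \<noteq> (par ^^ i) a"
      by (cases i) (auto simp del: funpow.simps simp: funpow_Suc_right)
  qed
  consider "x = y" | "y < x" | "x < y" by linarith
  then show ?case
  proof cases
    case 1
    then show ?thesis by (intro exI[of _ 0] exI[of _ "[x]"]) simp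
  next
    case 2
    with par[of x] have "par x < x" by linarith
    then obtain k l xs where *: "length xs = k + l + 1" "hd xs = par x" "last xs = y" "distinct xs"
      "successively (parent_adj par) xs" "set xs \<subseteq> {..max (par x) y}"
      "\<forall>i<k. \<forall>j. (par ^^ i) (par x) \<noteq> (par ^^ j) y" "\<forall>j<l. \<forall>i. (par ^^ j) y \<noteq> (par ^^ i) (par x)"
      using less[of "par x" y] by auto
    have "xs \<noteq> []" using *(1) by auto
    have "x \<notin> set xs" using *(6) \<open>par x < x\<close> 2 by auto
    moreover have "parent_adj par x (par x)" using 2 by (simp add: parent_adj_def)
    ultimately show ?thesis
      using * \<open>xs \<noteq> []\<close> 2 \<open>par x < x\<close> step[OF 2 *(7)] keep[OF 2 *(8)]
      by (intro exI[of _ "Suc k"] exI[of _ l] exI[of _ "x # xs"])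
        (auto simp: successively_Cons simp del: funpow.simps)
  next
    case 3
    with par[of y] have "par y < y" by linarith
    then obtain k l xs where *: "length xs = k + l + 1" "hd xs = x" "last xs = par y" "distinct xs"
      "successively (parent_adj par) xs" "set xs \<subseteq> {..max x (par y)}"
      "\<forall>i<k. \<forall>j. (par ^^ i) x \<noteq> (par ^^ j) (par y)" "\<forall>j<l. \<forall>i. (par ^^ j) (par y) \<noteq> (par ^^ i) x"
      using less[of x "par y"] by auto
    have "xs \<noteq> []" using *(1) by auto
    have "y \<notin> set xs" using *(6) \<open>par y < y\<close> 3 by auto
    moreover have "parent_adj par (par y) y" using 3 by (simp add: parent_adj_def)
    ultimately show ?thesis
      using * \<open>xs \<noteq> []\<close> 3 \<open>par y < y\<close> step[OF 3 *(8)] keep[OF 3 *(7)]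
      by (intro exI[of _ k] exI[of _ "Suc l"] exI[of _ "xs @ [y]"])
        (auto simp: successively_append_iff simp del: funpow.simps)
  qed
qed

section \<open>Counting the choices that create unwanted adjacencies\<close>

text \<open>\<open>\<phi> c i\<close> is the image of tree vertex \<open>i\<close> under the choices
  \<open>c\<close>. \<open>determined\<close> reflects that images are built from the root
  downwards, \<open>separated\<close> that layers are disjoint. Choice functions are extensional, so
  that they can be counted.\<close>

locale choice_embedding =
  fixes R :: "'a \<Rightarrow> 'a \<Rightarrow> bool" and par :: "nat \<Rightarrow> nat" and s m L :: nat
    and \<phi> :: "(nat \<Rightarrow> nat) \<Rightarrow> nat \<Rightarrow> 'a"
  assumes symp_R: "symp R"
    and girth_R: "no_short_cycles R (2 * L + 2)"
    and par_le: "par i \<le> i - 1"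
    and adj: "\<lbrakk>c \<in> {1..<s} \<rightarrow>\<^sub>E {..<m}; 0 < i; i < s\<rbrakk> \<Longrightarrow> R (\<phi> c i) (\<phi> c (par i))"
    and determined: "(\<And>k. c ((par ^^ k) i) = c' ((par ^^ k) i)) \<Longrightarrow> \<phi> c i = \<phi> c' i"
    and separated: "\<lbrakk>c \<in> {1..<s} \<rightarrow>\<^sub>E {..<m}; c' \<in> {1..<s} \<rightarrow>\<^sub>E {..<m}; i < s; j < s; \<phi> c i = \<phi> c' j\<rbrakk>
      \<Longrightarrow> i = j \<and> c i = c' i"
begin

abbreviation "C \<equiv> {1..<s} \<rightarrow>\<^sub>E {..<m}"

lemma card_C: "card C = m ^ (s - 1)"
  by (simp add: card_PiE)

lemma adj_R:
  assumes "c \<in> C" "i < s" "j < s" "parent_adj par i j"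
  shows "R (\<phi> c i) (\<phi> c j)"
  using assms adj symp_R unfolding parent_adj_def by (metis sympD)

lemma inj_embedding: "c \<in> C \<Longrightarrow> inj_on (\<phi> c) {..<s}"
  using separated by (auto intro!: inj_onI)

lemma funpow_lt: "x < s \<Longrightarrow> (par ^^ i) x < s"
  using funpow_parent_le[of par i x, OF par_le] by linarith

lemma successively_embedding:
  assumes "c \<in> C" "successively (parent_adj par) xs" "set xs \<subseteq> {..<s}"
  shows "successively R (map (\<phi> c) xs)"
  unfolding successively_map
  by (rule successively_mono[OF assms(2)]) (use assms(1,3) adj_R in blast)

text \<open>If both climbs to the common ancestor take at most \<open>L\<close> steps, the image of
  the tree path and the edge joining its ends are two paths with at most \<open>2 * L + 1\<close>
  edges in all. They coincide, so the tree path is a single edge.\<close>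

lemma far_or_adjacent:
  assumes c: "c \<in> C" and xy: "x < s" "y < s" "x \<noteq> y" "R (\<phi> c x) (\<phi> c y)"
  shows "parent_adj par x y \<or> (\<forall>i\<le>L. \<forall>j. (par ^^ i) x \<noteq> (par ^^ j) y)
    \<or> (\<forall>i\<le>L. \<forall>j. (par ^^ i) y \<noteq> (par ^^ j) x)"
proof -
  obtain k l xs where *: "length xs = k + l + 1" "hd xs = x" "last xs = y" "distinct xs"
    "successively (parent_adj par) xs" "set xs \<subseteq> {..max x y}"
    "\<forall>i<k. \<forall>j. (par ^^ i) x \<noteq> (par ^^ j) y" "\<forall>j<l. \<forall>i. (par ^^ j) y \<noteq> (par ^^ i) x"
    using parent_path[OF par_le, of x y] by blast
  have sub: "set xs \<subseteq> {..<s}" using *(6) xy(1,2) by auto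
  obtain zs where zs: "xs = x # zs" using *(1,2) by (cases xs) auto
  have "parent_adj par x y" if "k \<le> L" "l \<le> L"
  proof -
    have inj: "inj_on (\<phi> c) (set xs)" using inj_embedding[OF c] sub by (rule inj_on_subset)
    have ne: "\<phi> c x \<noteq> \<phi> c y" using inj_embedding[OF c] xy by (auto dest: inj_onD)
    have "map (\<phi> c) zs = [\<phi> c y]"
    proof (rule unique_short_path[OF symp_R girth_R])
      show "successively R (\<phi> c x # map (\<phi> c) zs)"
        using successively_embedding[OF c *(5) sub] zs by simp
      show "distinct (\<phi> c x # map (\<phi> c) zs)"
        using inj *(4) zs by (metis distinct_map list.simps(9))
      show "last (\<phi> c x # map (\<phi> c) zs) = last [\<phi> c x, \<phi> c y]"
        using *(3) zs xy(3) by (auto simp: last_map)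
      show "length (map (\<phi> c) zs) + length [\<phi> c y] \<le> 2 * L + 2"
        using *(1) zs that by simp
    qed (use xy(4) ne in auto)
    then obtain z where "zs = [z]" by (cases zs) auto
    then show ?thesis using zs *(3,5) by auto
  qed
  then show ?thesis using *(7,8) by (meson le_less_trans linorder_not_less)
qed

text \<open>The choices along the last \<open>L\<close> steps above \<open>x\<close> are forced by the remaining ones: they trace a
  path of length \<open>L + 1\<close> between two vertices that no longer depend on them.\<close>

lemma card_bad_choices:
  assumes xy: "x < s" "y < s" and far: "\<forall>i\<le>L. \<forall>j. (par ^^ i) x \<noteq> (par ^^ j) y"
  shows "card {c \<in> C. R (\<phi> c x) (\<phi> c y)} * m ^ L \<le> m ^ (s - 1)"
proof -
  let ?B = "{c \<in> C. R (\<phi> c x) (\<phi> c y)}"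
  define S where "S = (\<lambda>i. (par ^^ i) x) ` {..<L}"
  \<comment> \<open>The root is an ancestor of \<open>y\<close>, so \<open>far\<close> keeps the
    first \<open>L\<close> steps above \<open>x\<close> from reaching it. Up to there the ancestors
    of \<open>x\<close> strictly decrease and are distinct.\<close>
  have "(par ^^ y) y = 0" using funpow_parent_le[OF par_le, of y y] by simp
  with far have pos: "0 < (par ^^ i) x" if "i \<le> L" for i
    using that by (metis gr0I)
  have less: "(par ^^ j) x < (par ^^ i) x" if "i < j" "i \<le> L" for i j
    using funpow_parent_less[OF par_le that(1) pos[OF that(2)]] .
  have inj: "inj_on (\<lambda>i. (par ^^ i) x) {..L}"
    by (rule inj_onI) (metis atMost_iff less less_irrefl linorder_neqE_nat)
  have S: "S \<subseteq> {1..<s}"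
    using pos funpow_lt[OF xy(1)] by (force simp: S_def Suc_le_eq)
  have cardS: "card S = L"
    unfolding S_def by (subst card_image) (auto intro: inj_on_subset[OF inj])
  have "L \<le> s - 1"
    using card_mono[OF _ S] cardS by simp
  \<comment> \<open>A bad choice is recovered from its values outside \<open>S\<close>, which leaves
    at most \<open>m ^ (s - 1 - L)\<close> of them.\<close>
  have "inj_on (\<lambda>c. restrict c ({1..<s} - S)) ?B"
  proof (rule inj_onI)
    fix c c' assume c: "c \<in> ?B" and c': "c' \<in> ?B"
      and eq: "restrict c ({1..<s} - S) = restrict c' ({1..<s} - S)"
    have off: "c i = c' i" if "i \<notin> S" for i
    proof (cases "i \<in> {1..<s}")
      case True
      then show ?thesis using fun_cong[OF eq, of i] that by simp
    next
      case False
      then show ?thesis using c c' by (metis (no_types, lifting) PiE_arb mem_Collect_eq)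
    qed
    \<comment> \<open>Both ends of the forced path are independent of the choices in
      \<open>S\<close>: the ancestors of \<open>y\<close> avoid \<open>S\<close> by
      \<open>far\<close>, and those of \<open>(par ^^ L) x\<close> are smaller than every member of
      \<open>S\<close>.\<close>
    have "\<phi> c y = \<phi> c' y"
    proof (rule determined, rule off)
      show "(par ^^ k) y \<notin> S" for k
      proof
        assume "(par ^^ k) y \<in> S"
        then obtain i where "i < L" "(par ^^ k) y = (par ^^ i) x" by (auto simp: S_def)
        with far show False by (metis less_imp_le)
      qed
    qed
    have "\<phi> c ((par ^^ L) x) = \<phi> c' ((par ^^ L) x)"
    proof (rule determined, rule off)
      fix k
      have "(par ^^ k) ((par ^^ L) x) = (par ^^ (k + L)) x" by (simp add: funpow_add)
      then show "(par ^^ k) ((par ^^ L) x) \<notin> S"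
        using less by (auto simp: S_def) (metis add.commute less_irrefl less_imp_le trans_less_add1)
    qed
    \<comment> \<open>Preceded by the image of \<open>y\<close>, this path has \<open>L + 1\<close>
      edges, so two such paths together exactly reach the bound \<open>2 * L + 2\<close>.\<close>
    let ?p = "\<lambda>c. map (\<lambda>i. \<phi> c ((par ^^ i) x)) [0..<Suc L]"
    have path: "successively R (\<phi> d y # ?p d)" "distinct (\<phi> d y # ?p d)"
      if "d \<in> ?B" for d
    proof -
      have d: "d \<in> C" and "R (\<phi> d y) (\<phi> d x)" using that symp_R by (auto dest: sympD)
      have "successively R (map (\<lambda>i. \<phi> d ((par ^^ i) x)) [0..<n])" if "n \<le> Suc L" for n
        using that
      proof (induction n)
        case (Suc n)
        have "R (\<phi> d ((par ^^ (n - 1)) x)) (\<phi> d ((par ^^ n) x))" if "0 < n"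
        proof -
          obtain n' where "n = Suc n'" using \<open>0 < n\<close> gr0_implies_Suc by blast
          then show ?thesis
            using adj[OF d pos[of n'] funpow_lt[OF xy(1)]] Suc.prems by simp
        qed
        with Suc show ?case
          by (cases "n = 0") (auto simp: successively_append_iff last_map)
      qed simp
      from this[of "Suc L"] show "successively R (\<phi> d y # ?p d)"
        using \<open>R (\<phi> d y) (\<phi> d x)\<close>
        by (auto simp: successively_Cons hd_map simp del: upt_Suc)
      have "distinct (?p d)"
        unfolding distinct_map
        using separated[OF d d funpow_lt[OF xy(1)] funpow_lt[OF xy(1)]] inj
        by (auto intro!: inj_onI simp del: upt_Suc) (metis atMost_iff inj_onD less_Suc_eq_le)
      moreover have "\<phi> d y \<notin> set (?p d)"
      proof
        assume "\<phi> d y \<in> set (?p d)"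
        then obtain i where "i \<in> set [0..<Suc L]" and i: "\<phi> d y = \<phi> d ((par ^^ i) x)"
          unfolding set_map by blast
        then have "i \<le> L" by auto
        have "(par ^^ i) x = (par ^^ 0) y"
          using separated[OF d d xy(2) funpow_lt[OF xy(1)] i] by simp
        with far \<open>i \<le> L\<close> show False by blast
      qed
      ultimately show "distinct (\<phi> d y # ?p d)" by simp
    qed
    have "?p c = ?p c'"
    proof (rule unique_short_path[OF symp_R girth_R])
      show "successively R (\<phi> c y # ?p c)" "distinct (\<phi> c y # ?p c)"
        using path[OF c] by auto
      show "successively R (\<phi> c y # ?p c')" "distinct (\<phi> c y # ?p c')"
        using path[OF c'] \<open>\<phi> c y = \<phi> c' y\<close> by auto
    qed (use \<open>\<phi> c ((par ^^ L) x) = \<phi> c' ((par ^^ L) x)\<close> in auto)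
    then have "\<phi> c ((par ^^ i) x) = \<phi> c' ((par ^^ i) x)" if "i < L" for i
      using that by (auto simp: map_eq_conv)
    \<comment> \<open>By \<open>separated\<close>, an image reveals the choice made for it.\<close>
    then have on: "c i = c' i" if "i \<in> S" for i
      using that c c' separated[OF _ _ funpow_lt[OF xy(1)] funpow_lt[OF xy(1)]]
      unfolding S_def by blast
    show "c = c'" by (rule ext) (metis on off)
  qed
  moreover have "(\<lambda>c. restrict c ({1..<s} - S)) ` ?B \<subseteq> ({1..<s} - S) \<rightarrow>\<^sub>E {..<m}"
    by (rule image_subsetI) (auto simp: restrict_PiE_iff dest: PiE_mem)
  ultimately have "card ?B \<le> card (({1..<s} - S) \<rightarrow>\<^sub>E {..<m})"
    by (intro card_inj_on_le) (auto intro: finite_PiE)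
  also have "\<dots> = m ^ (s - 1 - L)"
    using S cardS finite_subset[OF S] by (simp add: card_PiE card_Diff_subset)
  finally have "card ?B * m ^ L \<le> m ^ (s - 1 - L) * m ^ L" by simp
  also have "\<dots> = m ^ (s - 1)" using \<open>L \<le> s - 1\<close> by (metis le_add_diff_inverse2 power_add)
  finally show ?thesis .
qed

text \<open>Union bound: there are fewer than \<open>s ^ 2\<close> ordered bad pairs, and each
  spoils at most a fraction \<open>1 / m ^ L\<close> of the choices.\<close>

lemma exists_induced_choice:
  assumes "1 \<le> s" "0 < m" "s ^ 2 \<le> m ^ L"
  shows "\<exists>c\<in>C. \<forall>x<s. \<forall>y<s. x \<noteq> y \<longrightarrow> R (\<phi> c x) (\<phi> c y) \<longrightarrow> parent_adj par x y"
proof (rule ccontr)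
  assume none: "\<not> ?thesis"
  let ?B = "\<lambda>(x, y). {c \<in> C. R (\<phi> c x) (\<phi> c y)}"
  define P where "P = {(x, y). x < s \<and> y < s \<and> x \<noteq> y
    \<and> \<not> parent_adj par x y \<and> (\<forall>i\<le>L. \<forall>j. (par ^^ i) x \<noteq> (par ^^ j) y)}"
  \<comment> \<open>Leaving out \<open>(0, 0)\<close> makes the bound on \<open>card P\<close>
    strict.\<close>
  have P: "P \<subseteq> {..<s} \<times> {..<s} - {(0, 0)}" by (auto simp: P_def)
  then have "finite P" by (rule finite_subset) simp
  have "card P \<le> s ^ 2 - 1"
    using card_mono[OF _ P] assms(1) by (simp add: card_Diff_subset power2_eq_square)
  then have "card P < s ^ 2" using assms(1) by (simp add: le_less_trans)
  have "C \<subseteq> (\<Union>q\<in>P. ?B q)"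
  proof
    fix c assume c: "c \<in> C"
    with none obtain x y where xy: "x < s" "y < s" "x \<noteq> y" "R (\<phi> c x) (\<phi> c y)" "\<not> parent_adj par x y"
      by blast
    \<comment> \<open>In \<open>P\<close> the first entry is the far one, so the pair may have to be
      swapped.\<close>
    have "R (\<phi> c y) (\<phi> c x)" using symp_R xy(4) by (rule sympD)
    then have "(x, y) \<in> P \<or> (y, x) \<in> P"
      using far_or_adjacent[OF c xy(1-4)] xy parent_adj_sym by (auto simp: P_def)
    with c xy(4) \<open>R (\<phi> c y) (\<phi> c x)\<close> show "c \<in> (\<Union>q\<in>P. ?B q)" by blast
  qed
  moreover have "finite C" by (auto intro: finite_PiE)
  moreover have "finite (?B q)" for q
    using \<open>finite C\<close> by (auto simp: split_def)
  ultimately have "card C \<le> card (\<Union>q\<in>P. ?B q)"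
    using \<open>finite P\<close> by (intro card_mono) auto
  also have "\<dots> \<le> (\<Sum>q\<in>P. card (?B q))" using \<open>finite P\<close> by (rule card_UN_le)
  finally have "card C * m ^ L \<le> (\<Sum>q\<in>P. card (?B q) * m ^ L)"
    by (simp add: sum_distrib_right[symmetric])
  also have "\<dots> \<le> (\<Sum>q\<in>P. m ^ (s - 1))"
    by (rule sum_mono) (use card_bad_choices in \<open>auto simp: P_def\<close>)
  also have "\<dots> = card P * m ^ (s - 1)" by simp
  also have "\<dots> < s ^ 2 * m ^ (s - 1)" using \<open>card P < s ^ 2\<close> assms(2) by simp
  also have "\<dots> \<le> m ^ L * m ^ (s - 1)" using assms(3) by simp
  finally show False unfolding card_C by (simp add: mult.commute)
qed

end


section \<open>Adjacency and girth of the underlying graph\<close>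

definition adjacent :: "('a, 'b) pre_digraph \<Rightarrow> 'a \<Rightarrow> 'a \<Rightarrow> bool" where
  "adjacent G u v \<longleftrightarrow> u \<rightarrow>\<^bsub>G\<^esub> v \<or> v \<rightarrow>\<^bsub>G\<^esub> u"

lemma symp_adjacent: "symp (adjacent G)"
  by (auto simp: adjacent_def intro: sympI)

lemma underlying_graph_simps [simp]:
  "verts (underlying_graph G) = verts G"
  "arcs (underlying_graph G) = {(u, v). adjacent G u v}"
  "tail (underlying_graph G) = fst"
  "head (underlying_graph G) = snd"
  by (auto simp: underlying_graph_def parcs_mk_symmetric adjacent_def arcs_ends_conv)

lemma dominates_underlying_graph: "u \<rightarrow>\<^bsub>underlying_graph G\<^esub> v \<longleftrightarrow> adjacent G u v"
  by (auto simp: arcs_ends_conv)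

lemma dominates_induce_subgraph: "u \<rightarrow>\<^bsub>G \<restriction> X\<^esub> v \<longleftrightarrow> u \<rightarrow>\<^bsub>G\<^esub> v \<and> u \<in> X \<and> v \<in> X"
  by (auto simp: arcs_ends_conv)

context wf_digraph
begin

lemma undirected_cycle_of_vertices:
  assumes "3 \<le> length xs" "distinct xs" "successively (adjacent G) xs" "adjacent G (last xs) (hd xs)"
  shows "\<exists>p. undirected_cycle (underlying_graph G) p \<and> length p = length xs"
proof -
  let ?H = "underlying_graph G"
  interpret H: wf_digraph ?H
    by unfold_locales (auto simp: adjacent_def dest: adj_in_verts)
  obtain u us where xs: "xs = u # us" using assms(1) by (cases xs) auto
  \<comment> \<open>Arcs of the underlying graph are pairs of vertices, so zipping a vertex list
    with its shift gives the arcs of the walk.\<close>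
  have cas: "H.cas a (zip (a # as) (as @ [b])) b" for a as b
    by (induction as arbitrary: a) auto
  have arcs: "successively (adjacent G) (a # as @ [b]) \<Longrightarrow> set (zip (a # as) (as @ [b])) \<subseteq> arcs ?H" for a as b
    by (induction as arbitrary: a) auto
  let ?p = "zip (u # us) (us @ [u])"
  have "successively (adjacent G) ((u # us) @ [u])"
    using assms(3,4) unfolding xs by (subst successively_append_iff) simp
  then have p: "set ?p \<subseteq> arcs ?H" by (intro arcs) simp
  have "u \<in> verts G"
  proof -
    have "(u, hd (us @ [u])) \<in> set ?p" by (cases us) auto
    with p have "adjacent G u (hd (us @ [u]))" by auto
    then show ?thesis by (auto simp: adjacent_def dest: adj_in_verts)
  qed
  with p cas have walk: "H.awalk u ?p u" by (simp add: H.awalk_def)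
  have "tl (H.awalk_verts u ?p) = map (head ?H) ?p"
    using H.awalk_verts_conv'[OF cas, of u us u] by simp
  also have "\<dots> = us @ [u]" by simp
  finally have "distinct (tl (H.awalk_verts u ?p))" using assms(2) xs by auto
  with walk have "H.cycle ?p" by (auto simp: H.cycle_def)
  moreover have "length ?p = length xs" by (simp add: xs)
  ultimately show ?thesis using assms(1) unfolding undirected_cycle_def by metis
qed

lemma no_short_cycles_girth:
  assumes "enat n < girth (underlying_graph G)"
  shows "no_short_cycles (adjacent G) n"
  unfolding no_short_cycles_def
proof (intro allI impI notI)
  fix xs assume xs: "3 \<le> length xs \<and> length xs \<le> n \<and> distinct xs \<and> successively (adjacent G) xs"
    "adjacent G (last xs) (hd xs)"
  then obtain p where "undirected_cycle (underlying_graph G) p" "length p = length xs"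
    using undirected_cycle_of_vertices by blast
  then have "girth (underlying_graph G) \<le> enat (length xs)"
    unfolding girth_def by (metis (mono_tags, lifting) INF_lower mem_Collect_eq)
  also have "\<dots> \<le> enat n" using xs by simp
  finally show False using assms by simp
qed

end

section \<open>Layers from kernels and antikernels\<close>

text \<open>The removed sets are independent, so \<open>N\<close> of them exhausting the graph would
  colour it with \<open>N\<close> colours. A vertex of a later layer survived the removal of layer
  \<open>a\<close>, hence has the required neighbour in that kernel or antikernel.\<close>

lemma kernel_layers:
  fixes \<tau> :: "nat \<Rightarrow> bool"
  assumes "bikernel_perfect G" and wf: "wf_digraph G"
    and N: "N < chromatic_number (underlying_graph G)"
  obtains K where "K N \<noteq> {}" "\<forall>t. K t \<subseteq> verts G"
    "\<forall>a b. a < b \<longrightarrow> b \<le> N \<longrightarrow> K a \<inter> K b = {}"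
    "\<forall>a b. a < b \<longrightarrow> b \<le> N \<longrightarrow> (\<forall>u\<in>K b. \<exists>v\<in>K a. if \<tau> a then u \<rightarrow>\<^bsub>G\<^esub> v else v \<rightarrow>\<^bsub>G\<^esub> u)"
proof -
  define pick where "pick t X = (SOME S. if \<tau> t then kernel (G \<restriction> X) S else antikernel (G \<restriction> X) S)" for t X
  define rest where "rest = rec_nat (verts G) (\<lambda>t X. X - pick t X)"
  have rest_0: "rest 0 = verts G" and rest_Suc: "rest (Suc t) = rest t - pick t (rest t)" for t
    by (simp_all add: rest_def)
  have anti: "a \<le> b \<Longrightarrow> rest b \<subseteq> rest a" for a b
    by (rule lift_Suc_antimono_le[of rest]) (auto simp: rest_Suc)
  define part where "part t = pick t (rest t)" for t
  have pick: "if \<tau> t then kernel (G \<restriction> rest t) (part t) else antikernel (G \<restriction> rest t) (part t)" for t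
  proof -
    have "rest t \<subseteq> verts G" using anti[of 0 t] rest_0 by simp
    then have "\<exists>S. if \<tau> t then kernel (G \<restriction> rest t) S else antikernel (G \<restriction> rest t) S"
      using assms(1) by (auto simp: bikernel_perfect_def)
    then show ?thesis unfolding part_def pick_def by (rule someI_ex)
  qed
  then have ind: "independent_set (G \<restriction> rest t) (part t)" for t
    by (metis kernel_def antikernel_def)
  then have part_sub: "part t \<subseteq> rest t" for t by (auto simp: independent_set_def)
  have dom: "\<exists>v\<in>part t. if \<tau> t then u \<rightarrow>\<^bsub>G\<^esub> v else v \<rightarrow>\<^bsub>G\<^esub> u" if "u \<in> rest (Suc t)" for t u
    using that pick[of t]
    by (auto simp: rest_Suc part_def kernel_def antikernel_def dominates_induce_subgraph split: if_splits)
  \<comment> \<open>Layer \<open>N\<close> is the whole remainder, so the bound on the chromatic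
    number makes it nonempty.\<close>
  define K where "K t = (if t < N then part t else rest t)" for t
  have K_sub: "K t \<subseteq> rest t" for t using part_sub by (simp add: K_def)
  have "K N \<noteq> {}"
  proof
    assume "K N = {}"
    have cover: "\<exists>t<n. v \<in> part t" if "v \<in> verts G" "v \<notin> rest n" for v n
      using that by (induction n) (auto simp: rest_0 rest_Suc part_def less_Suc_eq)
    define c where "c v = (SOME t. t < N \<and> v \<in> part t)" for v
    have c: "c v < N \<and> v \<in> part (c v)" if "v \<in> verts G" for v
    proof -
      have "\<exists>t. t < N \<and> v \<in> part t" using cover[OF that, of N] \<open>K N = {}\<close> by (simp add: K_def)
      then show ?thesis unfolding c_def by (rule someI_ex)
    qed
    have "c u \<noteq> c v" if "adjacent G u v" for u v
    proof
      assume eq: "c u = c v"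
      have "u \<in> verts G" "v \<in> verts G"
        using that wf by (auto simp: adjacent_def dest: wf_digraph.adj_in_verts)
      then have "u \<in> part (c u)" "v \<in> part (c u)" using c eq by metis+
      then show False
        using that ind[of "c u"] part_sub[of "c u"]
        by (auto simp: adjacent_def independent_set_def dominates_induce_subgraph)
    qed
    with c have "proper_colouring (underlying_graph G) N c"
      by (simp add: proper_colouring_def dominates_underlying_graph)
    then have "chromatic_number (underlying_graph G) \<le> N"
      unfolding chromatic_number_def by (intro Least_le) blast
    with N show False by simp
  qed
  moreover have "K t \<subseteq> verts G" for t using K_sub anti[of 0 t] rest_0 by blast
  moreover have "K a \<inter> K b = {}" if "a < b" "b \<le> N" for a b
    using that K_sub[of b] anti[of "Suc a" b] by (auto simp: K_def rest_Suc part_def)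
  moreover have "\<exists>v\<in>K a. if \<tau> a then u \<rightarrow>\<^bsub>G\<^esub> v else v \<rightarrow>\<^bsub>G\<^esub> u" if "a < b" "b \<le> N" "u \<in> K b" for a b u
  proof -
    have "u \<in> rest (Suc a)" using that K_sub[of b] anti[of "Suc a" b] by auto
    then show ?thesis using dom[of u a] that by (simp add: K_def)
  qed
  ultimately show ?thesis by (intro that[of K]) blast+
qed

section \<open>Ordering a tree from its root outwards\<close>

text \<open>Vertices are added one at a time. Connectivity supplies an edge from the placed vertices
  to a new \<open>y\<close>; a second such edge would close a cycle with the tree path between the
  two neighbours, so the parent of \<open>y\<close> is unique.\<close>

lemma tree_ordering:
  fixes R :: "'v \<Rightarrow> 'v \<Rightarrow> bool"
  assumes "finite V" "V \<noteq> {}" "symp R" "irreflp R"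
    and connected: "\<And>X. \<lbrakk>X \<noteq> {}; X \<subset> V\<rbrakk> \<Longrightarrow> \<exists>x\<in>X. \<exists>y\<in>V - X. R x y"
    and acyclic: "\<And>n. no_short_cycles R n"
  obtains f par where "bij_betw f {..<card V} V" "\<forall>i. par i \<le> i - 1"
    "\<forall>i<card V. \<forall>j<card V. R (f i) (f j) \<longleftrightarrow> parent_adj par i j"
proof -
  have "\<exists>f par. inj_on f {..<n} \<and> f ` {..<n} \<subseteq> V \<and> (\<forall>i. par i \<le> i - 1)
      \<and> (\<forall>i<n. \<forall>j<n. R (f i) (f j) \<longleftrightarrow> parent_adj par i j)"
    if "1 \<le> n" "n \<le> card V" for n
    using that
  proof (induction n rule: nat_induct_at_least)
    case base
    obtain v where "v \<in> V" using assms(2) by blast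
    with assms(4) show ?case
      by (intro exI[of _ "\<lambda>_. v"] exI[of _ "\<lambda>_. 0"]) (auto simp: parent_adj_def irreflp_def inj_on_def)
  next
    case (Suc n)
    obtain f par where fp: "inj_on f {..<n} \<and> f ` {..<n} \<subseteq> V \<and> (\<forall>i. par i \<le> i - 1)
        \<and> (\<forall>i<n. \<forall>j<n. R (f i) (f j) \<longleftrightarrow> parent_adj par i j)"
      using Suc.IH[OF Suc_leD[OF Suc.prems]] by (elim exE)
    then have f: "inj_on f {..<n}" "f ` {..<n} \<subseteq> V"
      and R: "i < n \<Longrightarrow> j < n \<Longrightarrow> R (f i) (f j) \<longleftrightarrow> parent_adj par i j" for i j
      by simp_all
    from fp have par: "par i \<le> i - 1" for i by blast
    have "card (f ` {..<n}) < card V" using f(1) Suc by (simp add: card_image)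
    then have "f ` {..<n} \<subset> V" using f(2) by auto
    then obtain p y where p: "p < n" and y: "y \<in> V" "y \<notin> f ` {..<n}" and "R (f p) y"
      using connected[of "f ` {..<n}"] Suc(1) by (auto simp: lessThan_empty_iff)
    have y_adj: "R (f i) y \<longleftrightarrow> i = p" if "i < n" for i
    proof
      assume "R (f i) y"
      show "i = p"
      proof (rule ccontr)
        assume "i \<noteq> p"
        obtain xs where xs: "xs \<noteq> []" "hd xs = i" "last xs = p" "distinct xs"
          "successively (parent_adj par) xs" "set xs \<subseteq> {..max i p}"
          using parent_path[OF par, of i p] by (metis add_is_0 length_0_conv one_neq_zero)
        have sub: "set xs \<subseteq> {..<n}" using xs(6) \<open>i < n\<close> p by auto
        let ?c = "map f xs @ [y]"
        have "2 \<le> length xs"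
          using xs(1-3) \<open>i \<noteq> p\<close> by (cases xs; cases "tl xs") auto
        then have "3 \<le> length ?c" by simp
        moreover have "distinct ?c"
          using xs(4) inj_on_subset[OF f(1) sub] y(2) sub by (auto simp: distinct_map)
        moreover have "successively R (map f xs)"
          unfolding successively_map
          by (rule successively_mono[OF xs(5)]) (use R sub in blast)
        then have "successively R ?c"
          using xs(1,3) \<open>R (f p) y\<close> by (simp add: successively_append_iff last_map)
        moreover have "R (last ?c) (hd ?c)"
          using xs(1,2) \<open>R (f i) y\<close> assms(3) by (simp add: hd_append hd_map sympD)
        ultimately show False
          using acyclic[of "length ?c"] unfolding no_short_cycles_def by blast
      qed
    qed (use \<open>R (f p) y\<close> in simp)
    then have y_adj': "R y (f i) \<longleftrightarrow> i = p" if "i < n" for i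
      using that assms(3) by (metis sympD)
    have par_lt: "par i < n" if "i < n" for i using par[of i] that by linarith
    have "\<not> R y y" using assms(4) by (simp add: irreflp_def)
    have "R ((f(n := y)) i) ((f(n := y)) j) \<longleftrightarrow> parent_adj (par(n := p)) i j"
      if "i < Suc n" "j < Suc n" for i j
      using that R[of i j] y_adj[of i] y_adj'[of j] par_lt[of i] par_lt[of j] p \<open>\<not> R y y\<close>
      by (auto simp: less_Suc_eq parent_adj_def)
    moreover have "inj_on (f(n := y)) {..<Suc n}"
      using f(1) y(2) by (auto simp: lessThan_Suc inj_on_def)
    moreover have "(f(n := y)) ` {..<Suc n} \<subseteq> V" using f(2) y(1) by (auto simp: lessThan_Suc)
    moreover have "(par(n := p)) i \<le> i - 1" for i using par p by auto
    ultimately show ?case by blast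
  qed
  from this[of "card V"] obtain f par where fp: "inj_on f {..<card V} \<and> f ` {..<card V} \<subseteq> V
      \<and> (\<forall>i. par i \<le> i - 1) \<and> (\<forall>i<card V. \<forall>j<card V. R (f i) (f j) \<longleftrightarrow> parent_adj par i j)"
    using assms(1,2) by (auto simp: Suc_le_eq card_gt_0_iff)
  then have "bij_betw f {..<card V} V"
    unfolding bij_betw_def using assms(1) by (simp add: card_image card_subset_eq)
  with fp show ?thesis by (intro that[of f par]) blast+
qed

lemma oriented_tree_ordering:
  assumes "oriented_tree T"
  obtains f par where "bij_betw f {..<card (verts T)} (verts T)" "\<forall>i. par i \<le> i - 1"
    "\<forall>i<card (verts T). \<forall>j<card (verts T). adjacent T (f i) (f j) \<longleftrightarrow> parent_adj par i j"
proof -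
  interpret oriented_graph T using assms by (simp add: oriented_tree_def)
  have conn: "strongly_connected (mk_symmetric T)"
    using assms by (simp add: oriented_tree_def connected_def)
  show ?thesis
  proof (rule tree_ordering[of "verts T" "adjacent T"])
    show "verts T \<noteq> {}" using conn by (simp add: strongly_connected_def)
    show "irreflp (adjacent T)" by (auto simp: irreflp_def adjacent_def dest: adj_not_same)
    fix X assume X: "X \<noteq> {}" "X \<subset> verts T"
    then obtain x y where x: "x \<in> X" and y: "y \<in> verts T" "y \<notin> X" by blast
    have "x \<rightarrow>\<^sup>*\<^bsub>with_proj (mk_symmetric T)\<^esub> y"
      using conn x y(1) X(2) by (auto simp: strongly_connected_def)
    then have "(x, y) \<in> (arcs_ends (underlying_graph T))\<^sup>*"
      unfolding underlying_graph_def by (rule reachable_rtranclI)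
    \<comment> \<open>A walk from \<open>x\<close> in \<open>X\<close> to \<open>y\<close> outside
      leaves \<open>X\<close> along some edge.\<close>
    then have "\<exists>a\<in>X. \<exists>b. b \<notin> X \<and> adjacent T a b"
      using y(2) by (induction rule: rtrancl_induct) (use x dominates_underlying_graph in \<open>metis+\<close>)
    then show "\<exists>a\<in>X. \<exists>b\<in>verts T - X. adjacent T a b"
      by (auto simp: adjacent_def dest: adj_in_verts)
  next
    show "no_short_cycles (adjacent T) n" for n
      using assms undirected_cycle_of_vertices unfolding oriented_tree_def no_short_cycles_def by blast
  qed (fact finite_verts | fact symp_adjacent | fact that)+
qed

section \<open>Induced copies from vertex maps\<close>

text \<open>Without parallel arcs, an arc is determined by its ends, so the vertex map dictates the
  arc map \<open>k\<close>.\<close>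

lemma contains_inducedI:
  fixes T :: "('c, 'd) pre_digraph" and G :: "('a, 'b) pre_digraph"
  assumes "digraph T" "digraph G" "inj_on h (verts T)" "h ` verts T \<subseteq> verts G"
    and dom: "\<And>u v. \<lbrakk>u \<in> verts T; v \<in> verts T\<rbrakk> \<Longrightarrow> h u \<rightarrow>\<^bsub>G\<^esub> h v \<longleftrightarrow> u \<rightarrow>\<^bsub>T\<^esub> v"
  shows "contains_induced G T"
proof -
  interpret T: digraph T by fact
  interpret G: digraph G by fact
  define k where "k e = (SOME e'. e' \<in> arcs G \<and> tail G e' = h (tail T e) \<and> head G e' = h (head T e))" for e
  have k: "k e \<in> arcs G" "tail G (k e) = h (tail T e)" "head G (k e) = h (head T e)" if "e \<in> arcs T" for e
  proof -
    have "tail T e \<rightarrow>\<^bsub>T\<^esub> head T e" using that by (auto simp: arcs_ends_conv)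
    then have "h (tail T e) \<rightarrow>\<^bsub>G\<^esub> h (head T e)" using dom that by simp
    then have "\<exists>e'. e' \<in> arcs G \<and> tail G e' = h (tail T e) \<and> head G e' = h (head T e)"
      by (auto elim!: reachableE)
    from someI_ex[OF this]
    show "k e \<in> arcs G" "tail G (k e) = h (tail T e)" "head G (k e) = h (head T e)"
      unfolding k_def by auto
  qed
  let ?X = "h ` verts T"
  \<comment> \<open>Reusing \<open>head G\<close> and \<open>tail G\<close> makes the image of
    \<open>T\<close> literally equal to the induced subdigraph of \<open>G\<close>.\<close>
  let ?f = "\<lparr>iso_verts = h, iso_arcs = k, iso_head = head G, iso_tail = tail G\<rparr>"
  have "inj_on k (arcs T)"
  proof (rule inj_onI)
    fix d e assume de: "d \<in> arcs T" "e \<in> arcs T" "k d = k e"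
    then have "h (tail T d) = h (tail T e)" "h (head T d) = h (head T e)" by (metis k)+
    then have "arc_to_ends T d = arc_to_ends T e"
      using assms(3) de by (auto simp: arc_to_ends_def dest: inj_onD)
    with de show "d = e" by (intro T.no_multi_arcs)
  qed
  then have "T.digraph_isomorphism ?f"
    unfolding T.digraph_isomorphism_def using assms(3) k T.wf_digraph by simp
  moreover have "arcs (G \<restriction> ?X) = k ` arcs T"
  proof (intro equalityI subsetI)
    fix e assume "e \<in> arcs (G \<restriction> ?X)"
    then obtain u v where e: "e \<in> arcs G" "u \<in> verts T" "v \<in> verts T" "tail G e = h u" "head G e = h v"
      by auto
    then have "h u \<rightarrow>\<^bsub>G\<^esub> h v" by (metis arc_to_ends_def G.dominatesI)
    then obtain d where d: "d \<in> arcs T" "tail T d = u" "head T d = v" using dom e by (auto elim!: reachableE)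
    then have "arc_to_ends G (k d) = arc_to_ends G e" using e k by (simp add: arc_to_ends_def)
    then have "k d = e" using e(1) k(1)[OF d(1)] by (intro G.no_multi_arcs)
    then show "e \<in> k ` arcs T" using d(1) by blast
  qed (use k in auto)
  then have "G \<restriction> ?X = app_iso ?f T"
    by (simp add: app_iso_def induce_subgraph_def)
  ultimately show ?thesis
    using assms(4) unfolding contains_induced_def digraph_iso_def by blast
qed

section \<open>Embedding the tree into the layers\<close>

text \<open>\<open>nxt i a u\<close> is the image of vertex \<open>i\<close> for choice
  \<open>a\<close> when its parent has image \<open>u\<close>, and \<open>r\<close> is the image of
  the root. The guard both detects the root and ensures termination.\<close>

fun descend :: "(nat \<Rightarrow> nat) \<Rightarrow> (nat \<Rightarrow> nat \<Rightarrow> 'a \<Rightarrow> 'a) \<Rightarrow> 'a \<Rightarrow> (nat \<Rightarrow> nat) \<Rightarrow> nat \<Rightarrow> 'a" where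
  "descend par nxt r c i = (if par i < i then nxt i (c i) (descend par nxt r c (par i)) else r)"

declare descend.simps [simp del]

lemma descend_cong:
  "(\<And>k. c ((par ^^ k) i) = c' ((par ^^ k) i)) \<Longrightarrow> descend par nxt r c i = descend par nxt r c' i"
proof (induction i rule: less_induct)
  case (less i)
  have "c ((par ^^ k) (par i)) = c' ((par ^^ k) (par i))" for k
    using less.prems[of "Suc k"] by (simp add: funpow_swap1)
  with less.IH[of "par i"] have "par i < i \<Longrightarrow> descend par nxt r c (par i) = descend par nxt r c' (par i)"
    by blast
  then show ?case using less.prems[of 0] by (simp add: descend.simps[of par nxt r _ i])
qed

text \<open>Layers realise \<open>choice_embedding\<close>: each non-root vertex \<open>i\<close>
  owns a block of \<open>m\<close> consecutive layers, from which \<open>c i\<close> selects one.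
  The types of the layers take care of the arc directions.\<close>

lemma contains_induced_tree:
  fixes T :: "('c, 'd) pre_digraph" and G :: "('a, 'b) pre_digraph"
  assumes "oriented_graph G" "bikernel_perfect G" "oriented_tree T"
    and s: "s = card (verts T)" and "0 < m" "s ^ 2 \<le> m ^ L"
    and girth: "enat (2 * L + 2) < girth (underlying_graph G)"
    and chi: "m * (s - 1) < chromatic_number (underlying_graph G)"
  shows "contains_induced G T"
proof -
  interpret G: oriented_graph G by fact
  interpret T: oriented_graph T using assms(3) by (simp add: oriented_tree_def)
  obtain f par where f: "bij_betw f {..<s} (verts T)" and *: "\<forall>i. par i \<le> i - 1"
    "\<forall>i<s. \<forall>j<s. adjacent T (f i) (f j) \<longleftrightarrow> parent_adj par i j"
    by (rule oriented_tree_ordering[OF assms(3), folded s])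
  from *(1) have par: "par i \<le> i - 1" for i by blast
  from *(2) have adjT: "\<lbrakk>i < s; j < s\<rbrakk> \<Longrightarrow> adjacent T (f i) (f j) \<longleftrightarrow> parent_adj par i j" for i j by blast
  have "1 \<le> s"
    using assms(3) unfolding s oriented_tree_def connected_def strongly_connected_def
    by (simp add: Suc_le_eq card_gt_0_iff)
  define N where "N = (s - 1) * m"
  define up where "up i \<longleftrightarrow> f i \<rightarrow>\<^bsub>T\<^esub> f (par i)" for i
  have "N < chromatic_number (underlying_graph G)" using chi by (simp add: N_def mult.commute)
  \<comment> \<open>Layer \<open>a\<close> belongs to tree vertex \<open>s - 1 - a div m\<close>. As
    the parent sits in a later layer, layer \<open>a\<close> must be an antikernel if the arc points
    to the parent, and a kernel otherwise.\<close>
  then obtain K where K: "K N \<noteq> {}" "\<forall>t. K t \<subseteq> verts G"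
    "\<forall>a b. a < b \<longrightarrow> b \<le> N \<longrightarrow> K a \<inter> K b = {}"
    "\<forall>a b. a < b \<longrightarrow> b \<le> N \<longrightarrow>
      (\<forall>u\<in>K b. \<exists>v\<in>K a. if \<not> up (s - 1 - a div m) then u \<rightarrow>\<^bsub>G\<^esub> v else v \<rightarrow>\<^bsub>G\<^esub> u)"
    by (rule kernel_layers[OF assms(2) G.wf_digraph, of N "\<lambda>a. \<not> up (s - 1 - a div m)"])
  obtain r where r: "r \<in> K N" using K(1) by blast
  text \<open>Neighbours are guaranteed only in earlier layers, so children must be placed in earlier layers than their parents.\<close>
  define lev where "lev c i = (s - 1 - i) * m + (if i = 0 then 0 else c i)" for c i
  define step where "step i a u = (SOME v. v \<in> K ((s - 1 - i) * m + a)
      \<and> (if up i then v \<rightarrow>\<^bsub>G\<^esub> u else u \<rightarrow>\<^bsub>G\<^esub> v))" for i a u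
  define \<phi> where "\<phi> = descend par step r"
  let ?C = "{1..<s} \<rightarrow>\<^sub>E {..<m}"
  have c_lt: "c i < m" if "c \<in> ?C" "0 < i" "i < s" for c i
    using that by (auto simp: PiE_iff)
  have lev_div: "lev c i div m = s - 1 - i" if "c \<in> ?C" "i < s" for c i
    using c_lt[OF that(1)] that(2) \<open>0 < m\<close> by (simp add: lev_def)
  have lev_less: "lev c i < lev c j" if "c \<in> ?C" "j < i" "i < s" for c i j
  proof -
    have "lev c i < (s - 1 - i) * m + m" using c_lt[OF that(1), of i] that by (simp add: lev_def)
    also have "\<dots> = (s - 1 - i + 1) * m" by (simp add: algebra_simps)
    also have "\<dots> \<le> (s - 1 - j) * m" using that by (intro mult_le_mono1) linarith
    also have "\<dots> \<le> lev c j" by (simp add: lev_def)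
    finally show ?thesis .
  qed
  \<comment> \<open>Choice functions carry no meaningful value at the root, so \<open>lev\<close>
    uses offset 0 there, which is the remainder layer.\<close>
  have lev_0: "lev c 0 = N" for c by (simp add: lev_def N_def)
  have lev_le: "lev c i \<le> N" if "c \<in> ?C" "i < s" for c i
    using lev_less[OF that(1), of 0 i] that lev_0 by (cases "i = 0") (auto simp: less_imp_le)
  have step: "\<phi> c i \<in> K (lev c i) \<and> (if up i then \<phi> c i \<rightarrow>\<^bsub>G\<^esub> \<phi> c (par i) else \<phi> c (par i) \<rightarrow>\<^bsub>G\<^esub> \<phi> c i)"
    if "c \<in> ?C" "0 < i" "i < s" "\<phi> c (par i) \<in> K (lev c (par i))" for c i
  proof -
    have "par i < i" using par[of i] that(2) by linarith
    have "\<exists>v. v \<in> K (lev c i) \<and> (if up i then v \<rightarrow>\<^bsub>G\<^esub> \<phi> c (par i) else \<phi> c (par i) \<rightarrow>\<^bsub>G\<^esub> v)"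
    proof -
      have "lev c (par i) \<le> N" using lev_le[OF that(1)] that(3) \<open>par i < i\<close> by simp
      then have "\<exists>v\<in>K (lev c i). if \<not> up (s - 1 - lev c i div m) then \<phi> c (par i) \<rightarrow>\<^bsub>G\<^esub> v
          else v \<rightarrow>\<^bsub>G\<^esub> \<phi> c (par i)"
        using K(4) lev_less[OF that(1) \<open>par i < i\<close> that(3)] that(4) by blast
      moreover have "s - 1 - lev c i div m = i" using lev_div[OF that(1,3)] that(2,3) by simp
      ultimately show ?thesis by (auto split: if_splits)
    qed
    moreover have "\<phi> c i = step i (c i) (\<phi> c (par i))"
      unfolding \<phi>_def using \<open>par i < i\<close> by (simp add: descend.simps[of par step r c i])
    moreover have "lev c i = (s - 1 - i) * m + c i" using that by (simp add: lev_def)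
    ultimately show ?thesis unfolding step_def by (smt (verit, best) someI_ex)
  qed
  have in_K: "\<phi> c i \<in> K (lev c i)" if "c \<in> ?C" "i < s" for c i
    using that(2)
  proof (induction i rule: less_induct)
    case (less i)
    show ?case
    proof (cases "i = 0")
      case True
      then show ?thesis using r lev_0 by (simp add: \<phi>_def descend.simps)
    next
      case False
      then have "par i < i" using par[of i] by linarith
      with less False step[OF that(1), of i] show ?thesis by simp
    qed
  qed
  have arc: "if up i then \<phi> c i \<rightarrow>\<^bsub>G\<^esub> \<phi> c (par i) else \<phi> c (par i) \<rightarrow>\<^bsub>G\<^esub> \<phi> c i"
    if "c \<in> ?C" "0 < i" "i < s" for c i
    using step[OF that in_K[OF that(1)]] par[of i] that by simp
  interpret choice_embedding "adjacent G" par s m L \<phi>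
  proof
    show "symp (adjacent G)" by (rule symp_adjacent)
    show "no_short_cycles (adjacent G) (2 * L + 2)" using G.no_short_cycles_girth[OF girth] .
    show "par i \<le> i - 1" for i by (rule par)
    show "adjacent G (\<phi> c i) (\<phi> c (par i))" if "c \<in> ?C" "0 < i" "i < s" for c i
      using arc[OF that] by (auto simp: adjacent_def split: if_splits)
    show "\<phi> c i = \<phi> c' i" if "\<And>k. c ((par ^^ k) i) = c' ((par ^^ k) i)" for c c' i
      unfolding \<phi>_def by (rule descend_cong) (rule that)
    fix c c' i j assume *: "c \<in> ?C" "c' \<in> ?C" "i < s" "j < s" "\<phi> c i = \<phi> c' j"
    \<comment> \<open>Layers are disjoint, so equal images share their layer. Its block number
      yields \<open>i\<close> and its offset \<open>c i\<close>; at the root both choices have the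
      same default value.\<close>
    then have "\<phi> c i \<in> K (lev c i) \<inter> K (lev c' j)" using in_K by (metis IntI)
    then have lev: "lev c i = lev c' j"
      using K(3) lev_le[OF *(1,3)] lev_le[OF *(2,4)] by (metis Int_commute empty_iff linorder_neqE_nat)
    then have "s - 1 - i = s - 1 - j" using lev_div * by metis
    with *(3,4) have "i = j" by linarith
    moreover have "c i = c' i"
    proof (cases "i = 0")
      case True
      then have "i \<notin> {1..<s}" by simp
      then show ?thesis using *(1,2) by (metis PiE_arb)
    qed (use lev \<open>i = j\<close> in \<open>simp add: lev_def\<close>)
    ultimately show "i = j \<and> c i = c' i" ..
  qed
  obtain c where c: "c \<in> ?C" and good: "\<And>x y. \<lbrakk>x < s; y < s; x \<noteq> y; adjacent G (\<phi> c x) (\<phi> c y)\<rbrakk> \<Longrightarrow> parent_adj par x y"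
    using exists_induced_choice[OF \<open>1 \<le> s\<close> \<open>0 < m\<close> assms(6)] by blast
  \<comment> \<open>Opposite arcs being excluded in \<open>G\<close> and \<open>T\<close>, one arc
    in the right direction settles both equivalences.\<close>
  have dom_par: "(\<phi> c i \<rightarrow>\<^bsub>G\<^esub> \<phi> c (par i) \<longleftrightarrow> f i \<rightarrow>\<^bsub>T\<^esub> f (par i))
      \<and> (\<phi> c (par i) \<rightarrow>\<^bsub>G\<^esub> \<phi> c i \<longleftrightarrow> f (par i) \<rightarrow>\<^bsub>T\<^esub> f i)" if "0 < i" "i < s" for i
  proof -
    have "par i < s" using par[of i] that by linarith
    then have "adjacent T (f i) (f (par i))"
      using adjT[of i "par i"] that by (simp add: parent_adj_def)
    then show ?thesis
      using arc[OF c that] G.no_opposite_arcs T.no_opposite_arcs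
      unfolding adjacent_def up_def by (metis (full_types))
  qed
  have dom: "\<phi> c i \<rightarrow>\<^bsub>G\<^esub> \<phi> c j \<longleftrightarrow> f i \<rightarrow>\<^bsub>T\<^esub> f j" if "i < s" "j < s" for i j
  proof (cases "parent_adj par i j")
    case True
    then show ?thesis using dom_par that by (auto simp: parent_adj_def)
  next
    case False
    then have "\<not> f i \<rightarrow>\<^bsub>T\<^esub> f j" using adjT[OF that] by (auto simp: adjacent_def)
    moreover have "\<not> \<phi> c i \<rightarrow>\<^bsub>G\<^esub> \<phi> c j"
      using good[OF that] False G.adj_not_same by (auto simp: adjacent_def)
    ultimately show ?thesis by simp
  qed
  let ?g = "the_inv_into {..<s} f"
  have g: "?g v < s" "f (?g v) = v" if "v \<in> verts T" for v
    using that f bij_betwE[OF bij_betw_the_inv_into[OF f]] by (auto simp: f_the_inv_into_f_bij_betw)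
  show ?thesis
  proof (rule contains_inducedI[of _ _ "\<lambda>v. \<phi> c (?g v)"])
    show "digraph T" "digraph G" by unfold_locales
    show "inj_on (\<lambda>v. \<phi> c (?g v)) (verts T)"
      using inj_embedding[OF c] g by (intro inj_onI) (metis inj_onD lessThan_iff)
    show "(\<lambda>v. \<phi> c (?g v)) ` verts T \<subseteq> verts G"
      using in_K[OF c] K(2) g(1) by blast
    show "\<phi> c (?g u) \<rightarrow>\<^bsub>G\<^esub> \<phi> c (?g v) \<longleftrightarrow> u \<rightarrow>\<^bsub>T\<^esub> v" if "u \<in> verts T" "v \<in> verts T" for u v
      using dom[OF g(1)[OF that(1)] g(1)[OF that(2)]] g(2) that by simp
  qed
qed

section \<open>Numerical choice of \<open>m\<close> and \<open>L\<close>\<close>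

text \<open>For finite girth, rounding up gives \<open>s powr e \<le> m\<close> and
  \<open>m < s powr e + 1 \<le> 2 * s powr e\<close>, so \<open>m * (s - 1)\<close> stays below
  \<open>2 * s powr (1 + e)\<close>, while \<open>2 \<le> e * L\<close> yields
  \<open>s ^ 2 \<le> m ^ L\<close>.\<close>

lemma embedding_parameters:
  fixes s :: nat and g :: enat
  assumes "s \<ge> 1" "g \<ge> 5"
    and X: "real X \<ge> 2 * real s powr real_of_ereal (1 + 4 / (ereal_of_enat g - 4))"
  obtains m L where "0 < m" "s ^ 2 \<le> m ^ L" "enat (2 * L + 2) < g" "m * (s - 1) < X"
proof (cases g)
  case infinity
  \<comment> \<open>Division by infinity gives 0, so the exponent is 1.\<close>
  have "real X \<ge> 2 * real s" using X assms(1) by (simp add: infinity)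
  then have "2 * (s - 1) < X" using assms(1) by linarith
  moreover have "s ^ 2 \<le> 2 ^ s ^ 2" by (simp add: less_imp_le)
  ultimately show ?thesis using that[of 2 "s ^ 2"] infinity by simp
next
  case (enat n)
  have n: "5 \<le> n" using assms(2) enat by (metis enat_ord_simps(1) numeral_eq_enat)
  define e where "e = 4 / (real n - 4)"
  define m where "m = nat \<lceil>real s powr e\<rceil>"
  \<comment> \<open>This is the largest \<open>L\<close> with \<open>2 * L + 2 < n\<close>; it still
    satisfies \<open>n - 4 \<le> 2 * L\<close>.\<close>
  define L where "L = (n - 3) div 2"
  have "real_of_ereal (1 + 4 / (ereal_of_enat g - 4)) = 1 + e"
  proof -
    have "ereal_of_enat g - 4 = ereal (real n - 4)" by (simp add: enat flip: ereal_minus(1))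
    moreover have "4 / ereal (real n - 4) = ereal e"
      unfolding e_def using n by (simp only: numeral_eq_ereal ereal_divide) simp
    ultimately show ?thesis by simp
  qed
  with X have X: "2 * (real s * real s powr e) \<le> real X"
    using assms(1) by (simp add: powr_add)
  have "0 \<le> e" using n by (simp add: e_def)
  then have ge1: "1 \<le> real s powr e" using assms(1) by (simp add: ge_one_powr_ge_zero)
  have m: "real s powr e \<le> real m" "real m < real s powr e + 1"
    unfolding m_def using ge1 by linarith+
  have "2 \<le> e * real L"
  proof -
    have "n - 4 \<le> 2 * L" unfolding L_def using n by linarith
    then have "real n - 4 \<le> 2 * real L" using n by linarith
    then show ?thesis using n by (simp add: e_def field_simps)
  qed
  then have "real s powr 2 \<le> real s powr (e * real L)"
    using assms(1) by (intro powr_mono) auto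
  also have "\<dots> = (real s powr e) ^ L" using assms(1) by (simp add: powr_powr[symmetric] powr_realpow)
  also have "\<dots> \<le> real m ^ L" using m(1) by (intro power_mono) auto
  finally have "real (s ^ 2) \<le> real (m ^ L)" using assms(1) by (simp add: powr_numeral)
  then have 1: "s ^ 2 \<le> m ^ L" by (simp only: of_nat_le_iff)
  have 2: "0 < m" using m(1) ge1 by linarith
  have 3: "enat (2 * L + 2) < g" using n by (simp add: enat L_def)
  have "real (m * (s - 1)) \<le> 2 * real s powr e * (real s - 1)"
    using m ge1 assms(1) by (simp add: of_nat_diff mult_right_mono)
  also have "\<dots> < 2 * (real s * real s powr e)"
    using ge1 assms(1) by (simp add: algebra_simps)
  finally have 4: "m * (s - 1) < X" using X by linarith
  show ?thesis using that[OF 2 1 3 4] .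
qed

theorem theorem10:
  fixes G :: "('a, 'b) pre_digraph" and s :: nat and g :: enat
  assumes "s \<ge> 1"
    and "oriented_graph G"
    and "bikernel_perfect G"
    and "girth (underlying_graph G) = g"
    and "g \<ge> 5"
    and "real (chromatic_number (underlying_graph G))
           \<ge> 2 * real s powr real_of_ereal (1 + 4 / (ereal_of_enat g - 4))"
  shows "\<forall>T :: ('c, 'd) pre_digraph.
           oriented_tree T \<and> card (verts T) = s \<longrightarrow> contains_induced G T"
proof -
  obtain m L where "0 < m" "s ^ 2 \<le> m ^ L" "enat (2 * L + 2) < g"
    "m * (s - 1) < chromatic_number (underlying_graph G)"
    using embedding_parameters[OF assms(1,5,6)] .
  then show ?thesis
    using contains_induced_tree[OF assms(2,3)] assms(4) by blast
qed

end
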